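(* Let $\eta\in\mathbb{R}\setminus\{0\}$, let $\varepsilon',\ell,\delta,\delta'>0$, let $A\in\mathrm{SL}(2,\mathbb{Z})$ and set $v=A(0,1)$. There exists $\xi_0=\xi_0(|\eta|,A,\ell,\varepsilon',\delta,\delta')\in\mathbb{N}^*$ with the following property. Let $X\subseteq\mathbb{R}^2$ be non-empty, let $\varepsilon>0$, and let $\gamma$ be a union of segments in $\mathbb{R}^2$ which is $\varepsilon$-dense in $X$, such that the direction of each segment of $\gamma$ is at distance greater than $\delta$ from the direction of $v$ on $\mathbb{S}^1$, and each segment of $\gamma$ has length greater than $\ell$. Then for every integer $\xi\ge\xi_0$ there exists a subset $\gamma'\subseteq A\circ J_{\eta,\xi}\circ A^{-1}(\gamma)$ which is a union of segments, is $(\varepsilon+\varepsilon')$-dense in $\mathrm{Str}(X,\eta v)$, whose segments have directions within distance $\delta'$ of the direction of $v$ on $\mathbb{S}^1$, and whose segments have lengths greater than $\|A^{-1}\|^{-1}|\eta|$.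
   Context: Directions of non-zero vectors of $\mathbb{R}^2$ are identified with the unit circle $\mathbb{S}^1$, equipped with the Riemannian metric induced by the Euclidean metric of $\mathbb{R}^2$. $\|\cdot\|$ is the operator norm. $X$ is $\varepsilon$-dense in $Y$ if $Y\subseteq B_\varepsilon(X)$ (open $\varepsilon$-neighbourhood). $\mathrm{Str}(X,w)=X+[-w,w]$ (Minkowski sum). For $\xi\in\mathbb{N}^*$, $\phi_\xi(x)=(-1)^{z+1}(4\xi x-2z-1)$ for $z\in\mathbb{Z}$, $x\in[\frac{z}{2\xi},\frac{z+1}{2\xi})$, and $J_{\eta,\xi}(x,y)=(x,y+\eta\phi_\xi(x))$. *)

theory Defs
  imports "HOL-Analysis.Analysis"
begin

type_synonym pt = "real^2"

text \<open>Geodesic distance on the unit circle between the directions of two non-zero vectors.\<close>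
definition dir_dist :: "pt \<Rightarrow> pt \<Rightarrow> real" where
  "dir_dist u w = arccos ((u \<bullet> w) / (norm u * norm w))"

text \<open>X is eps-dense in Y: Y is contained in the open eps-neighbourhood of X.\<close>
definition eps_dense :: "real \<Rightarrow> pt set \<Rightarrow> pt set \<Rightarrow> bool" where
  "eps_dense eps X Y \<longleftrightarrow> (\<forall>y\<in>Y. \<exists>x\<in>X. dist x y < eps)"

text \<open>Str(X,w) = X + [-w,w] (Minkowski sum).\<close>
definition Str :: "pt set \<Rightarrow> pt \<Rightarrow> pt set" where
  "Str X w = {x + y | x y. x \<in> X \<and> y \<in> closed_segment (-w) w}"

definition phi :: "nat \<Rightarrow> real \<Rightarrow> real" where
  "phi \<xi> x = (let z = \<lfloor>2 * real \<xi> * x\<rfloor> in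
      (-1::real) powi (z + 1) * (4 * real \<xi> * x - 2 * real_of_int z - 1))"

definition J :: "real \<Rightarrow> nat \<Rightarrow> pt \<Rightarrow> pt" where
  "J \<eta> \<xi> p = vector [p$1, p$2 + \<eta> * phi \<xi> (p$1)]"

text \<open>Union of a family of (non-degenerate) segments, given by endpoint pairs.\<close>
definition segs_union :: "(pt \<times> pt) set \<Rightarrow> pt set" where
  "segs_union S = (\<Union>(p,q)\<in>S. closed_segment p q)"

definition SL2Z :: "real^2^2 \<Rightarrow> bool" where
  "SL2Z A \<longleftrightarrow> (\<forall>i j. A$i$j \<in> \<int>) \<and> det A = 1"

end

theory Submission
  imports Defs
begin

text \<open>
  Conjugating by \<open>A\<close> turns the direction \<open>v\<close> into the vertical direction \<open>e\<^sub>2\<close>, and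
  \<open>J\<close> is a vertical shear by \<open>\<eta> \<phi>\<^sub>\<xi>(x)\<close>, where \<open>\<phi>\<^sub>\<xi>\<close> is affine with values
  \<open>\<mp>1\<close> and \<open>\<plusminus>1\<close> at the ends of each strip \<open>z \<le> 2\<xi>x \<le> z + 1\<close>. A segment whose
  direction is \<open>\<delta>\<close>-far from \<open>v\<close> becomes, under \<open>A\<^sup>-\<^sup>1\<close>, the graph of a function of slope at most
  \<open>K\<close> over an interval of length at least \<open>l |v| sin \<delta>\<close>. On each strip \<open>J\<close> maps the piece of such
  a segment affinely onto a segment with displacement \<open>\<plusminus>2\<eta> e\<^sub>2\<close> plus an error of size at most
  \<open>(1 + K)/(2\<xi>)\<close>, so for large \<open>\<xi>\<close> its image under \<open>A\<close> is almost parallel to \<open>v\<close> and longer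
  than \<open>|\<eta>| / \<parallel>A\<^sup>-\<^sup>1\<parallel>\<close>. A point \<open>x + \<tau>\<eta>v\<close> of \<open>Str(X, \<eta>v)\<close> is approximated by taking a
  point \<open>g\<close> of \<open>\<gamma>\<close> close to \<open>x\<close>, a strip piece next to \<open>A\<^sup>-\<^sup>1g\<close>, and the point of that
  piece where \<open>\<phi>\<^sub>\<xi> = \<tau>\<close>: it is moved by exactly \<open>\<tau>\<eta> e\<^sub>2\<close>.
\<close>

section \<open>Planar linear algebra and directions\<close>

lemma matrix_vector_mult_inv:
  fixes A :: "'a::comm_semiring_1^'n^'m"
  assumes "invertible A"
  shows matrix_vector_mult_inv_right: "A *v (matrix_inv A *v x) = x"
    and matrix_vector_mult_inv_left: "matrix_inv A *v (A *v y) = y"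
proof -
  have "A ** matrix_inv A = mat 1 \<and> matrix_inv A ** A = mat 1"
    using assms unfolding invertible_def matrix_inv_def by (rule someI_ex)
  then show "A *v (matrix_inv A *v x) = x" "matrix_inv A *v (A *v y) = y"
    by (simp_all add: matrix_vector_mul_assoc)
qed

lemma inverse_onorm_matrix_inv_le:
  fixes A :: "real^'n^'n"
  assumes "invertible A"
  shows "inverse (onorm ((*v) (matrix_inv A))) * norm x \<le> norm (A *v x)"
proof (cases "onorm ((*v) (matrix_inv A)) = 0")
  case False
  have "norm x \<le> onorm ((*v) (matrix_inv A)) * norm (A *v x)"
    using onorm[OF matrix_vector_mul_bounded_linear, of "matrix_inv A" "A *v x"]
    by (simp add: matrix_vector_mult_inv_left[OF assms])
  moreover have "onorm ((*v) (matrix_inv A)) > 0"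
    using False onorm_pos_le[OF matrix_vector_mul_bounded_linear] by (simp add: order_less_le)
  ultimately show ?thesis by (simp add: field_simps)
qed simp

lemma cross_matrix_vector_mult:
  fixes A :: "real^2^2"
  shows "(A *v x)$1 * (A *v y)$2 - (A *v x)$2 * (A *v y)$1 = det A * (x$1 * y$2 - x$2 * y$1)"
  by (simp add: matrix_vector_mult_def sum_2 det_2 algebra_simps)

lemma inner_sq_plus_cross_sq:
  fixes w v :: "real^2"
  shows "(w \<bullet> v)\<^sup>2 + (w$1 * v$2 - w$2 * v$1)\<^sup>2 = (norm w)\<^sup>2 * (norm v)\<^sup>2"
  unfolding power2_norm_eq_inner by (simp add: inner_vec_def sum_2 power2_eq_square algebra_simps)

lemma norm_le_slope:
  fixes x :: "real^2"
  assumes "\<bar>x$2\<bar> \<le> K * \<bar>x$1\<bar>"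
  shows "norm x \<le> (1 + K) * \<bar>x$1\<bar>"
  using norm_le_l1_cart[of x] assms by (simp add: sum_2 algebra_simps)

lemma closed_segment_scaled_component:
  fixes P Q :: "real^'n"
  shows "(\<lambda>a. c * a$k) ` closed_segment P Q = closed_segment (c * P$k) (c * Q$k)"
  by (rule closed_segment_linear_image[symmetric]) (auto intro: linearI simp: algebra_simps)

lemma closed_segment_diff_slope:
  fixes P Q a b :: "real^2"
  assumes "a \<in> closed_segment P Q" "b \<in> closed_segment P Q"
    and "\<bar>(Q - P)$2\<bar> \<le> K * \<bar>(Q - P)$1\<bar>"
  shows "\<bar>(b - a)$2\<bar> \<le> K * \<bar>(b - a)$1\<bar>"
proof -
  obtain s t where ab: "a = (1 - s) *\<^sub>R P + s *\<^sub>R Q" "b = (1 - t) *\<^sub>R P + t *\<^sub>R Q"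
    using assms(1,2) unfolding in_segment by blast
  have "b - a = (t - s) *\<^sub>R (Q - P)" unfolding ab by (simp add: algebra_simps)
  then show ?thesis unfolding \<open>b - a = _\<close>
    using mult_left_mono[OF assms(3) abs_ge_zero[of "t - s"]]
    by (simp add: abs_mult mult.left_commute)
qed

lemma cos_lt_of_dir_dist_gt:
  assumes "0 \<le> \<delta>" "dir_dist w v > \<delta>"
  shows "(w \<bullet> v) / (norm w * norm v) < cos \<delta>"
proof -
  define c where "c = (w \<bullet> v) / (norm w * norm v)"
  have "\<bar>c\<bar> \<le> 1"
    using Cauchy_Schwarz_ineq2[of w v] unfolding c_def
    by (cases "norm w * norm v = 0") (auto simp: abs_divide divide_le_eq_1)
  then have "cos (arccos c) < cos \<delta>"
    using assms arccos_ubound[of c] unfolding dir_dist_def c_def[symmetric]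
    by (intro cos_monotone_0_pi) auto
  with \<open>\<bar>c\<bar> \<le> 1\<close> show ?thesis unfolding c_def[symmetric] by simp
qed

lemma cross_gt_of_dir_dist_gt:
  fixes w v :: "real^2"
  assumes "0 \<le> \<delta>" "\<delta> \<le> pi / 2" "dir_dist w v > \<delta>" "dir_dist (-w) v > \<delta>" "w \<noteq> 0" "v \<noteq> 0"
  shows "sin \<delta> * norm w * norm v < \<bar>w$1 * v$2 - w$2 * v$1\<bar>"
proof -
  define c where "c = (w \<bullet> v) / (norm w * norm v)"
  have "c < cos \<delta>" "- c < cos \<delta>"
    using cos_lt_of_dir_dist_gt[OF assms(1) assms(3)] cos_lt_of_dir_dist_gt[OF assms(1) assms(4)]
    unfolding c_def by auto
  then have "\<bar>c\<bar>\<^sup>2 < (cos \<delta>)\<^sup>2"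
    by (intro power_strict_mono) auto
  moreover have "(w \<bullet> v)\<^sup>2 = c\<^sup>2 * (norm w * norm v)\<^sup>2"
    using assms(5,6) unfolding c_def by (simp add: power_divide)
  ultimately have "(w \<bullet> v)\<^sup>2 < (cos \<delta>)\<^sup>2 * (norm w * norm v)\<^sup>2"
    using assms(5,6) by simp
  moreover have
    "(sin \<delta> * norm w * norm v)\<^sup>2 = (norm w * norm v)\<^sup>2 - (cos \<delta>)\<^sup>2 * (norm w * norm v)\<^sup>2"
    by (simp add: power_mult_distrib sin_squared_eq algebra_simps)
  moreover have "(w \<bullet> v)\<^sup>2 + (w$1 * v$2 - w$2 * v$1)\<^sup>2 = (norm w * norm v)\<^sup>2"
    using inner_sq_plus_cross_sq[of w v] by (simp add: power_mult_distrib)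
  ultimately have "(sin \<delta> * norm w * norm v)\<^sup>2 < (w$1 * v$2 - w$2 * v$1)\<^sup>2"
    by linarith
  then have "(sin \<delta> * norm w * norm v)\<^sup>2 < \<bar>w$1 * v$2 - w$2 * v$1\<bar>\<^sup>2"
    by simp
  then show ?thesis by (rule power2_less_imp_less) simp
qed

lemma dir_dist_lt_of_near_multiple:
  fixes u v :: "real^2"
  assumes "v \<noteq> 0" "\<mu> > 0" "0 < \<delta>" "\<delta> \<le> pi / 2"
    and near: "norm (u - \<mu> *\<^sub>R v) \<le> (1 - cos \<delta>) / 2 * \<mu> * norm v"
  shows "dir_dist u v < \<delta>"
proof -
  \<comment> \<open>The cosine of the angle between \<open>u\<close> and \<open>v\<close> is at least \<open>(1 - \<rho>)/(1 + \<rho>) > 1 - 2\<rho> = cos \<delta>\<close>.\<close>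
  define \<rho> where "\<rho> = (1 - cos \<delta>) / 2"
  define e where "e = u - \<mu> *\<^sub>R v"
  have "0 \<le> cos \<delta>" using assms(3,4) by (intro cos_ge_zero) auto
  moreover have "cos \<delta> < cos 0" using assms(3,4) by (intro cos_monotone_0_pi) auto
  ultimately have \<rho>: "0 < \<rho>" "\<rho> \<le> 1 / 2" unfolding \<rho>_def by auto
  have m: "\<mu> * norm v > 0" using assms(1,2) by simp
  have ne: "norm e \<le> \<rho> * (\<mu> * norm v)" using near unfolding e_def \<rho>_def by simp
  have "- (e \<bullet> v) \<le> norm e * norm v" using Cauchy_Schwarz_ineq2[of e v] by linarith
  also have "\<dots> \<le> \<rho> * (\<mu> * norm v) * norm v" using ne by (simp add: mult_right_mono)
  finally have uv: "(1 - \<rho>) * (\<mu> * norm v) * norm v \<le> u \<bullet> v"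
    unfolding e_def by (simp add: inner_diff_left algebra_simps dot_square_norm power2_eq_square)
  have "norm u \<le> \<mu> * norm v + norm e"
    using norm_triangle_ineq[of "\<mu> *\<^sub>R v" e] assms(2) unfolding e_def by simp
  then have "norm u \<le> (1 + \<rho>) * (\<mu> * norm v)" using ne by (simp add: algebra_simps)
  then have nu: "norm u * norm v \<le> (1 + \<rho>) * (\<mu> * norm v) * norm v"
    by (simp add: mult_right_mono)
  have "cos \<delta> = 1 - 2 * \<rho>" unfolding \<rho>_def by (simp add: field_simps)
  then have "cos \<delta> * (norm u * norm v) \<le> (1 - 2 * \<rho>) * ((1 + \<rho>) * (\<mu> * norm v) * norm v)"
    using mult_left_mono[OF nu \<open>0 \<le> cos \<delta>\<close>] by simp
  also have "\<dots> < (1 - \<rho>) * (\<mu> * norm v) * norm v"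
  proof -
    have "0 < \<rho> * \<rho>" using \<rho> by simp
    then have "(1 - 2 * \<rho>) * (1 + \<rho>) < 1 - \<rho>" by (simp add: algebra_simps)
    moreover have "0 < \<mu> * norm v * norm v" using m assms(1) by simp
    ultimately have
      "(1 - 2 * \<rho>) * (1 + \<rho>) * (\<mu> * norm v * norm v) < (1 - \<rho>) * (\<mu> * norm v * norm v)"
      by (rule mult_strict_right_mono)
    then show ?thesis by (simp add: mult.assoc)
  qed
  also have "\<dots> \<le> u \<bullet> v" by (rule uv)
  finally have lt: "cos \<delta> * (norm u * norm v) < u \<bullet> v" .
  then have "u \<noteq> 0" using \<open>0 \<le> cos \<delta>\<close> by auto
  then have pos: "norm u * norm v > 0" using assms(1) by simp
  have "cos \<delta> < (u \<bullet> v) / (norm u * norm v)" using lt pos by (simp add: pos_less_divide_eq)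
  moreover have "(u \<bullet> v) / (norm u * norm v) \<le> 1"
    using norm_cauchy_schwarz[of u v] pos by (simp add: divide_le_eq_1)
  ultimately have "dir_dist u v < arccos (cos \<delta>)"
    unfolding dir_dist_def using \<open>0 \<le> cos \<delta>\<close> by (intro arccos_less_arccos) auto
  then show ?thesis using assms(3,4) by (simp add: arccos_cos)
qed

lemma dir_dist_lt_of_near_line:
  fixes e v :: "real^2"
  assumes "v \<noteq> 0" "\<mu> \<noteq> 0" "0 < \<delta>" "\<delta> \<le> pi / 2"
    and "norm e \<le> (1 - cos \<delta>) / 2 * \<bar>\<mu>\<bar> * norm v"
  shows "dir_dist (\<mu> *\<^sub>R v + e) v < \<delta> \<or> dir_dist (- (\<mu> *\<^sub>R v + e)) v < \<delta>"
proof (cases "\<mu> > 0")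
  case True
  have "norm ((\<mu> *\<^sub>R v + e) - \<mu> *\<^sub>R v) \<le> (1 - cos \<delta>) / 2 * \<mu> * norm v"
    using assms(5) True by simp
  then show ?thesis using dir_dist_lt_of_near_multiple[OF assms(1) True assms(3,4)] by blast
next
  case False
  then have neg: "- \<mu> > 0" using assms(2) by simp
  have "norm (- (\<mu> *\<^sub>R v + e) - (- \<mu>) *\<^sub>R v) \<le> (1 - cos \<delta>) / 2 * (- \<mu>) * norm v"
    using assms(5) False by simp
  then show ?thesis using dir_dist_lt_of_near_multiple[OF assms(1) neg assms(3,4)] by blast
qed

section \<open>The shear on strips\<close>

lemma phi_on_strip:
  assumes "real_of_int z \<le> 2 * real \<xi> * x" "2 * real \<xi> * x \<le> real_of_int z + 1"
  shows "phi \<xi> x = (-1) powi (z + 1) * (4 * real \<xi> * x - 2 * real_of_int z - 1)"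
proof (cases "2 * real \<xi> * x = real_of_int z + 1")
  case True
  then have "\<lfloor>2 * real \<xi> * x\<rfloor> = z + 1" by simp
  moreover have "(-1::real) powi (z + 1 + 1) = - ((-1) powi (z + 1))" by (simp add: power_int_add)
  moreover have "4 * real \<xi> * x = 2 * real_of_int z + 2" using True by linarith
  ultimately show ?thesis unfolding phi_def Let_def by simp
next
  case False
  then have "\<lfloor>2 * real \<xi> * x\<rfloor> = z" using assms by (simp add: floor_eq_iff)
  then show ?thesis unfolding phi_def Let_def by simp
qed

lemma J_eq_vertical_shift: "J \<eta> \<xi> p = p + (\<eta> * phi \<xi> (p$1)) *\<^sub>R vector [0, 1]"
  by (simp add: J_def vec_eq_iff forall_2)

lemma J_strip_displacement:
  assumes "2 * real \<xi> * \<alpha>$1 = real_of_int z" "2 * real \<xi> * \<beta>$1 = real_of_int z + 1"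
  shows "J \<eta> \<xi> \<beta> - J \<eta> \<xi> \<alpha> = (\<beta> - \<alpha>) + (2 * \<eta> * (-1) powi (z + 1)) *\<^sub>R vector [0, 1]"
proof -
  have a: "4 * real \<xi> * \<alpha>$1 - 2 * real_of_int z - 1 = -1"
    and b: "4 * real \<xi> * \<beta>$1 - 2 * real_of_int z - 1 = 1"
    using assms by linarith+
  have "phi \<xi> (\<alpha>$1) = - ((-1) powi (z + 1))" "phi \<xi> (\<beta>$1) = (-1) powi (z + 1)"
    using phi_on_strip[of z \<xi> "\<alpha>$1", unfolded a] phi_on_strip[of z \<xi> "\<beta>$1", unfolded b] assms
    by simp_all
  then show ?thesis unfolding J_eq_vertical_shift by (simp add: vec_eq_iff forall_2 algebra_simps)
qed

lemma J_image_closed_segment_on_strip: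
  assumes "real_of_int z \<le> 2 * real \<xi> * \<alpha>$1" "2 * real \<xi> * \<alpha>$1 \<le> real_of_int z + 1"
    and "real_of_int z \<le> 2 * real \<xi> * \<beta>$1" "2 * real \<xi> * \<beta>$1 \<le> real_of_int z + 1"
  shows "J \<eta> \<xi> ` closed_segment \<alpha> \<beta> = closed_segment (J \<eta> \<xi> \<alpha>) (J \<eta> \<xi> \<beta>)"
proof -
  define L where "L p = p + (\<eta> * (-1) powi (z + 1) * (4 * real \<xi> * p$1 - 2 * real_of_int z - 1))
    *\<^sub>R vector [0, 1]" for p :: pt
  have J_eq_L: "J \<eta> \<xi> p = L p" if "p \<in> closed_segment \<alpha> \<beta>" for p
  proof -
    have "2 * real \<xi> * p$1 \<in> closed_segment (2 * real \<xi> * \<alpha>$1) (2 * real \<xi> * \<beta>$1)"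
      using closed_segment_scaled_component that by blast
    then have "real_of_int z \<le> 2 * real \<xi> * p$1 \<and> 2 * real \<xi> * p$1 \<le> real_of_int z + 1"
      using assms by (auto simp: closed_segment_eq_real_ivl split: if_splits)
    then show ?thesis unfolding J_eq_vertical_shift L_def using phi_on_strip by simp
  qed
  have L_comb: "L ((1 - s) *\<^sub>R \<alpha> + s *\<^sub>R \<beta>) = (1 - s) *\<^sub>R L \<alpha> + s *\<^sub>R L \<beta>" for s
    unfolding L_def by (simp add: vec_eq_iff forall_2 algebra_simps)
  have "J \<eta> \<xi> ` closed_segment \<alpha> \<beta> = L ` closed_segment \<alpha> \<beta>"
    by (rule image_cong[OF refl J_eq_L])
  also have "\<dots> = closed_segment (L \<alpha>) (L \<beta>)"
    unfolding closed_segment_image_interval image_image L_comb ..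
  finally show ?thesis using J_eq_L[OF ends_in_segment(1)] J_eq_L[OF ends_in_segment(2)] by simp
qed

lemma integer_unit_interval_near:
  fixes a b g :: real
  assumes "g \<in> closed_segment a b" "4 \<le> \<bar>b - a\<bar>"
  shows "\<exists>z::int. real_of_int z \<in> closed_segment a b \<and> real_of_int z + 1 \<in> closed_segment a b \<and>
    g - 2 \<le> real_of_int z \<and> real_of_int z + 1 \<le> g + 2"
proof -
  have "min a b \<le> g" "g \<le> max a b" "4 \<le> max a b - min a b"
    using assms by (auto simp: closed_segment_eq_real_ivl split: if_splits)
  moreover obtain z :: int
    where "min a b \<le> z" "real_of_int z + 1 \<le> max a b" "g - 2 \<le> z" "real_of_int z + 1 \<le> g + 2"
  proof (cases "g + 2 \<le> max a b")
    case True
    show thesis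
      by (rule that[of "\<lceil>g\<rceil>"]) (use True \<open>min a b \<le> g\<close> in linarith)+
  next
    case False
    show thesis
      by (rule that[of "\<lfloor>g\<rfloor> - 1"]) (use False \<open>4 \<le> max a b - min a b\<close> \<open>g \<le> max a b\<close> in linarith)+
  qed
  ultimately show ?thesis by (intro exI[of _ z]) (auto simp: closed_segment_eq_real_ivl)
qed

text \<open>
  After conjugation by \<open>A\<close> the direction \<open>v\<close> is vertical, and segments transverse to it are
  graphs of slope at most \<open>K\<close> over intervals of length at least \<open>w\<close>.
\<close>
definition flat_segments :: "real \<Rightarrow> real \<Rightarrow> (pt \<times> pt) set \<Rightarrow> bool" where
  "flat_segments w K S \<longleftrightarrow> (\<forall>(P, Q)\<in>S. w \<le> \<bar>(Q - P)$1\<bar> \<and> \<bar>(Q - P)$2\<bar> \<le> K * \<bar>(Q - P)$1\<bar>)"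

lemma flat_segmentsD:
  "flat_segments w K S \<Longrightarrow> (P, Q) \<in> S \<Longrightarrow> w \<le> \<bar>(Q - P)$1\<bar> \<and> \<bar>(Q - P)$2\<bar> \<le> K * \<bar>(Q - P)$1\<bar>"
  unfolding flat_segments_def by blast

lemma flat_segments_mono: "flat_segments w K S \<Longrightarrow> w' \<le> w \<Longrightarrow> flat_segments w' K S"
  unfolding flat_segments_def by fastforce

text \<open>
  A piece of a segment cut out by a strip is encoded by its endpoints, which lie on the two
  boundary lines \<open>2\<xi>x = z\<close> and \<open>2\<xi>x = z + 1\<close> of the strip.
\<close>
definition strip_pieces :: "nat \<Rightarrow> (pt \<times> pt) set \<Rightarrow> (pt \<times> pt) set" where
  "strip_pieces \<xi> S = {(\<alpha>, \<beta>). \<exists>(P, Q)\<in>S. \<alpha> \<in> closed_segment P Q \<and> \<beta> \<in> closed_segment P Q \<and>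
     (\<exists>z::int. 2 * real \<xi> * \<alpha>$1 = z \<and> 2 * real \<xi> * \<beta>$1 = real_of_int z + 1)}"

lemma segs_unionI: "(p, q) \<in> S \<Longrightarrow> x \<in> closed_segment p q \<Longrightarrow> x \<in> segs_union S"
  unfolding segs_union_def by blast

lemma segs_unionE:
  assumes "x \<in> segs_union S"
  obtains p q where "(p, q) \<in> S" "x \<in> closed_segment p q"
  using assms unfolding segs_union_def by blast

lemma segs_union_linear_image:
  assumes "linear f"
  shows "segs_union (map_prod f f ` S) = f ` segs_union S"
  unfolding segs_union_def image_UN image_image
  by (intro SUP_cong refl) (simp add: case_prod_beta closed_segment_linear_image[OF assms])

lemma segs_union_J_strip_pieces:
  "segs_union (map_prod (J \<eta> \<xi>) (J \<eta> \<xi>) ` strip_pieces \<xi> S) \<subseteq> J \<eta> \<xi> ` segs_union S"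
proof
  fix y assume "y \<in> segs_union (map_prod (J \<eta> \<xi>) (J \<eta> \<xi>) ` strip_pieces \<xi> S)"
  then obtain \<alpha> \<beta> P Q z where PQ: "(P, Q) \<in> S" "\<alpha> \<in> closed_segment P Q" "\<beta> \<in> closed_segment P Q"
    and z: "2 * real \<xi> * \<alpha>$1 = real_of_int z" "2 * real \<xi> * \<beta>$1 = real_of_int z + 1"
    and y: "y \<in> closed_segment (J \<eta> \<xi> \<alpha>) (J \<eta> \<xi> \<beta>)"
    unfolding segs_union_def strip_pieces_def by auto
  have "y \<in> J \<eta> \<xi> ` closed_segment \<alpha> \<beta>"
    using y J_image_closed_segment_on_strip[of z \<xi> \<alpha> \<beta> \<eta>] z by simp
  moreover have "closed_segment \<alpha> \<beta> \<subseteq> closed_segment P Q"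
    using PQ by (simp add: subset_closed_segment)
  ultimately show "y \<in> J \<eta> \<xi> ` segs_union S"
    unfolding segs_union_def using PQ(1) by blast
qed

lemma J_strip_piece_displacement:
  assumes "(\<alpha>, \<beta>) \<in> strip_pieces \<xi> S" "\<xi> > 0" and flat: "flat_segments 0 K S"
  shows "\<exists>\<sigma>. \<bar>\<sigma>\<bar> = 1 \<and>
    norm (J \<eta> \<xi> \<beta> - J \<eta> \<xi> \<alpha> - (2 * \<eta> * \<sigma>) *\<^sub>R vector [0, 1]) \<le> (1 + K) / (2 * real \<xi>)"
proof -
  obtain P Q z where PQ: "(P, Q) \<in> S" "\<alpha> \<in> closed_segment P Q" "\<beta> \<in> closed_segment P Q"
    and z: "2 * real \<xi> * \<alpha>$1 = real_of_int z" "2 * real \<xi> * \<beta>$1 = real_of_int z + 1"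
    using assms(1) unfolding strip_pieces_def by auto
  have "(\<beta> - \<alpha>)$1 = 1 / (2 * real \<xi>)"
    using z assms(2) by (simp add: field_simps)
  moreover have "norm (\<beta> - \<alpha>) \<le> (1 + K) * \<bar>(\<beta> - \<alpha>)$1\<bar>"
    using flat_segmentsD[OF flat PQ(1)]
    by (intro norm_le_slope closed_segment_diff_slope[OF PQ(2,3)]) simp
  ultimately have "norm (\<beta> - \<alpha>) \<le> (1 + K) / (2 * real \<xi>)" by simp
  then show ?thesis
    using J_strip_displacement[OF z, of \<eta>]
    by (intro exI[of _ "(-1) powi (z + 1)"]) (simp add: power_int_abs)
qed

lemma strip_piece_hitting_phi_value:
  fixes P Q G :: pt
  assumes "G \<in> closed_segment P Q" "4 \<le> 2 * real \<xi> * \<bar>(Q - P)$1\<bar>" "\<bar>\<tau>\<bar> \<le> 1"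
  obtains z :: int and \<alpha> \<beta> W where "\<alpha> \<in> closed_segment P Q" "\<beta> \<in> closed_segment P Q"
    "2 * real \<xi> * \<alpha>$1 = z" "2 * real \<xi> * \<beta>$1 = real_of_int z + 1"
    "W \<in> closed_segment \<alpha> \<beta>" "phi \<xi> (W$1) = \<tau>" "\<bar>2 * real \<xi> * (W$1 - G$1)\<bar> \<le> 2"
proof -
  define t where "t a = 2 * real \<xi> * a$1" for a :: pt
  have t_seg: "t ` closed_segment a b = closed_segment (t a) (t b)" for a b
    unfolding t_def by (rule closed_segment_scaled_component)
  have "t G \<in> closed_segment (t P) (t Q)" unfolding t_seg[symmetric] using assms(1) by (rule imageI)
  moreover have "t Q - t P = 2 * real \<xi> * (Q - P)$1" unfolding t_def by (simp add: algebra_simps)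
  then have "4 \<le> \<bar>t Q - t P\<bar>" using assms(2) by (simp add: abs_mult)
  ultimately obtain z :: int where z: "real_of_int z \<in> closed_segment (t P) (t Q)"
      "real_of_int z + 1 \<in> closed_segment (t P) (t Q)" "t G - 2 \<le> z" "real_of_int z + 1 \<le> t G + 2"
    using integer_unit_interval_near by blast
  have "real_of_int z \<in> t ` closed_segment P Q" "real_of_int z + 1 \<in> t ` closed_segment P Q"
    using z(1,2) by (simp_all only: t_seg)
  then obtain \<alpha> \<beta> where \<alpha>: "\<alpha> \<in> closed_segment P Q" "t \<alpha> = z"
    and \<beta>: "\<beta> \<in> closed_segment P Q" "t \<beta> = real_of_int z + 1"
    by (metis imageE)
  define \<sigma> where "\<sigma> = (-1::real) powi (z + 1)"
  have \<sigma>: "\<bar>\<sigma>\<bar> = 1" unfolding \<sigma>_def by (simp add: power_int_abs)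
  then have "\<sigma> * \<sigma> = 1" by (metis abs_mult_self_eq mult_1)
  \<comment> \<open>On the strip \<open>\<phi>\<^sub>\<xi>\<close> is affine, from \<open>-\<sigma>\<close> at \<open>2\<xi>x = z\<close> to \<open>\<sigma>\<close> at \<open>2\<xi>x = z + 1\<close>,
    so it takes the value \<open>\<tau>\<close> at \<open>2\<xi>x = c\<close>.\<close>
  define c where "c = z + (1 + \<sigma> * \<tau>) / 2"
  have "\<bar>\<sigma> * \<tau>\<bar> \<le> 1" using assms(3) \<sigma> by (simp add: abs_mult)
  then have c: "real_of_int z \<le> c" "c \<le> real_of_int z + 1" unfolding c_def by auto
  then have "c \<in> t ` closed_segment \<alpha> \<beta>"
    unfolding t_seg \<alpha>(2) \<beta>(2) by (simp add: closed_segment_eq_real_ivl)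
  then obtain W where W: "W \<in> closed_segment \<alpha> \<beta>" "t W = c" by (metis imageE)
  have "4 * real \<xi> * W$1 = 2 * c" using W(2) unfolding t_def by simp
  then have "phi \<xi> (W$1) = \<sigma> * (2 * c - 2 * z - 1)"
    using phi_on_strip[of z \<xi> "W$1"] c W(2) unfolding t_def \<sigma>_def by simp
  also have "\<dots> = \<tau>" unfolding c_def using \<open>\<sigma> * \<sigma> = 1\<close> by (simp add: algebra_simps)
  finally have "phi \<xi> (W$1) = \<tau>" .
  moreover have "\<bar>t W - t G\<bar> \<le> 2" using c z(3,4) W(2) by linarith
  then have "\<bar>2 * real \<xi> * (W$1 - G$1)\<bar> \<le> 2" unfolding t_def by (simp add: right_diff_distrib)
  ultimately show thesis
    using \<alpha> \<beta> unfolding t_def by (intro that[where z = z, OF \<alpha>(1) \<beta>(1) _ _ W(1)]) simp_all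
qed

lemma J_strip_pieces_dense:
  assumes "\<xi> > 0" and flat: "flat_segments (2 / real \<xi>) K S"
    and PQ: "(P, Q) \<in> S" and G: "G \<in> closed_segment P Q" and \<tau>: "\<bar>\<tau>\<bar> \<le> 1"
  shows "\<exists>Z \<in> segs_union (map_prod (J \<eta> \<xi>) (J \<eta> \<xi>) ` strip_pieces \<xi> S).
    norm (Z - (G + (\<tau> * \<eta>) *\<^sub>R vector [0, 1])) \<le> (1 + K) / real \<xi>"
proof -
  have wide: "2 / real \<xi> \<le> \<bar>(Q - P)$1\<bar>" and slope: "\<bar>(Q - P)$2\<bar> \<le> K * \<bar>(Q - P)$1\<bar>"
    using flat_segmentsD[OF flat PQ] by simp_all
  have "4 \<le> 2 * real \<xi> * \<bar>(Q - P)$1\<bar>" using wide assms(1) by (simp add: field_simps)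
  then obtain z :: int and \<alpha> \<beta> W where \<alpha>\<beta>: "\<alpha> \<in> closed_segment P Q" "\<beta> \<in> closed_segment P Q"
    and z: "2 * real \<xi> * \<alpha>$1 = z" "2 * real \<xi> * \<beta>$1 = real_of_int z + 1"
    and W: "W \<in> closed_segment \<alpha> \<beta>" "phi \<xi> (W$1) = \<tau>" "\<bar>2 * real \<xi> * (W$1 - G$1)\<bar> \<le> 2"
    by (rule strip_piece_hitting_phi_value[OF G _ \<tau>])
  have "(\<alpha>, \<beta>) \<in> strip_pieces \<xi> S"
    unfolding strip_pieces_def using PQ \<alpha>\<beta> z by blast
  then have "(J \<eta> \<xi> \<alpha>, J \<eta> \<xi> \<beta>) \<in> map_prod (J \<eta> \<xi>) (J \<eta> \<xi>) ` strip_pieces \<xi> S"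
    by (rule rev_image_eqI) simp
  moreover have "J \<eta> \<xi> W \<in> closed_segment (J \<eta> \<xi> \<alpha>) (J \<eta> \<xi> \<beta>)"
    using J_image_closed_segment_on_strip[of z \<xi> \<alpha> \<beta> \<eta>] z W(1) by auto
  ultimately have JW: "J \<eta> \<xi> W \<in> segs_union (map_prod (J \<eta> \<xi>) (J \<eta> \<xi>) ` strip_pieces \<xi> S)"
    by (rule segs_unionI)
  have W_PQ: "W \<in> closed_segment P Q" using W(1) \<alpha>\<beta> subset_closed_segment by blast
  have "norm (J \<eta> \<xi> W - (G + (\<tau> * \<eta>) *\<^sub>R vector [0, 1])) = norm (W - G)"
    unfolding J_eq_vertical_shift W(2) by (simp add: mult.commute)
  also have "\<dots> \<le> (1 + K) * \<bar>(W - G)$1\<bar>"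
    by (rule norm_le_slope[OF closed_segment_diff_slope[OF G W_PQ slope]])
  also have "\<dots> \<le> (1 + K) * (1 / real \<xi>)"
  proof (rule mult_left_mono)
    have "2 * real \<xi> * \<bar>(W - G)$1\<bar> \<le> 2" using W(3) by (simp add: abs_mult)
    then show "\<bar>(W - G)$1\<bar> \<le> 1 / real \<xi>" using assms(1) by (simp add: field_simps)
    have "0 < 2 / real \<xi>" using assms(1) by simp
    then have "0 < \<bar>(Q - P)$1\<bar>" using wide by linarith
    moreover have "0 \<le> K * \<bar>(Q - P)$1\<bar>" using slope by (meson abs_ge_zero order_trans)
    ultimately show "0 \<le> 1 + K" by (simp add: zero_le_mult_iff)
  qed
  finally have "norm (J \<eta> \<xi> W - (G + (\<tau> * \<eta>) *\<^sub>R vector [0, 1])) \<le> (1 + K) / real \<xi>"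
    by simp
  with JW show ?thesis by blast
qed

section \<open>Conjugation by \<open>A\<close>\<close>

lemma norm_vector_0_1: "norm (vector [0, 1] :: real^2) = 1"
  by (simp add: norm_eq_sqrt_inner inner_vec_def sum_2)

lemma matrix_vector_mult_vector_0_1_neq_0:
  fixes A :: "real^2^2"
  assumes "invertible A"
  shows "A *v vector [0, 1] \<noteq> 0"
  using inj_matrix_vector_mult[OF assms] norm_vector_0_1
  by (metis injD matrix_vector_mult_0_right norm_zero zero_neq_one)

lemma flat_segments_matrix_inv_image:
  fixes A :: "real^2^2"
  assumes "det A = 1" "0 < \<delta>" "\<delta> \<le> pi / 2" "0 \<le> l" and v: "v = A *v vector [0, 1]"
    and transversal: "\<And>p q. (p, q) \<in> S \<Longrightarrow>
      dir_dist (q - p) v > \<delta> \<and> dir_dist (p - q) v > \<delta> \<and> dist p q > l"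
  shows "flat_segments (l * sin \<delta> * norm v) (onorm ((*v) (matrix_inv A)) / (sin \<delta> * norm v))
    (map_prod ((*v) (matrix_inv A)) ((*v) (matrix_inv A)) ` S)"
proof -
  define B where "B = matrix_inv A"
  have inv: "invertible A" using assms(1) by (simp add: invertible_det_nz)
  have "v \<noteq> 0"
    using matrix_vector_mult_vector_0_1_neq_0[OF inv] v by simp
  have sv: "0 < sin \<delta> * norm v" using assms(2,3) \<open>v \<noteq> 0\<close> by (simp add: sin_gt_zero)
  have "l * sin \<delta> * norm v \<le> \<bar>(B *v q - B *v p)$1\<bar> \<and>
    \<bar>(B *v q - B *v p)$2\<bar> \<le> onorm ((*v) B) / (sin \<delta> * norm v) * \<bar>(B *v q - B *v p)$1\<bar>"
    if "(p, q) \<in> S" for p q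
  proof
    define d where "d = B *v q - B *v p"
    have Ad: "A *v d = q - p"
      unfolding d_def B_def
      by (simp add: matrix_vector_mult_diff_distrib matrix_vector_mult_inv_right[OF inv])
    \<comment> \<open>Since \<open>det A = 1\<close>, the first coordinate of \<open>A\<^sup>-\<^sup>1 w\<close> is the cross product of \<open>w\<close> and \<open>v\<close>.\<close>
    have "(q - p)$1 * v$2 - (q - p)$2 * v$1 = d$1"
      unfolding Ad[symmetric] v using cross_matrix_vector_mult[of A d "vector [0, 1]"] assms(1)
      by simp
    moreover have "q - p \<noteq> 0" "l < norm (q - p)"
      using transversal[OF that] assms(4) by (auto simp: dist_norm norm_minus_commute)
    ultimately have wide: "sin \<delta> * norm (q - p) * norm v < \<bar>d$1\<bar>"
      using cross_gt_of_dir_dist_gt[of \<delta> "q - p" v] transversal[OF that] assms(2,3) \<open>v \<noteq> 0\<close>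
      by simp
    have "l * sin \<delta> * norm v \<le> sin \<delta> * norm (q - p) * norm v"
      using mult_right_mono[of l "norm (q - p)" "sin \<delta> * norm v"] \<open>l < norm (q - p)\<close> sv
      by (simp add: mult_ac)
    with wide show "l * sin \<delta> * norm v \<le> \<bar>(B *v q - B *v p)$1\<bar>" unfolding d_def by simp
    have "\<bar>d$2\<bar> \<le> norm d" by (rule component_le_norm_cart)
    also have "\<dots> \<le> onorm ((*v) B) * norm (q - p)"
      using onorm[OF matrix_vector_mul_bounded_linear, of B "q - p"]
      unfolding d_def by (simp add: matrix_vector_mult_diff_distrib)
    also have "\<dots> \<le> onorm ((*v) B) * (\<bar>d$1\<bar> / (sin \<delta> * norm v))"
      using wide sv onorm_pos_le[OF matrix_vector_mul_bounded_linear, of B]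
      by (intro mult_left_mono) (simp_all add: pos_le_divide_eq mult_ac)
    finally show "\<bar>(B *v q - B *v p)$2\<bar> \<le> onorm ((*v) B) / (sin \<delta> * norm v) * \<bar>(B *v q - B *v p)$1\<bar>"
      unfolding d_def by simp
  qed
  then show ?thesis unfolding flat_segments_def B_def by auto
qed

lemma Str_memE:
  assumes "y \<in> Str X w"
  obtains x \<tau> where "x \<in> X" "\<bar>\<tau>\<bar> \<le> 1" "y = x + \<tau> *\<^sub>R w"
proof -
  obtain x u where "x \<in> X" "0 \<le> u" "u \<le> 1" "y = x + ((1 - u) *\<^sub>R (- w) + u *\<^sub>R w)"
    using assms unfolding Str_def in_segment by blast
  moreover have "(1 - u) *\<^sub>R (- w) + u *\<^sub>R w = (2 * u - 1) *\<^sub>R w"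
    by (simp add: vec_eq_iff algebra_simps)
  ultimately show thesis using that[of x "2 * u - 1"] by simp
qed

text \<open>The family \<open>\<gamma>'\<close> of the theorem.\<close>
definition sheared_pieces :: "real \<Rightarrow> nat \<Rightarrow> real^2^2 \<Rightarrow> (pt \<times> pt) set \<Rightarrow> (pt \<times> pt) set" where
  "sheared_pieces \<eta> \<xi> A S = map_prod ((*v) A) ((*v) A) ` map_prod (J \<eta> \<xi>) (J \<eta> \<xi>) `
     strip_pieces \<xi> (map_prod ((*v) (matrix_inv A)) ((*v) (matrix_inv A)) ` S)"

lemma segs_union_sheared_pieces:
  "segs_union (sheared_pieces \<eta> \<xi> A S) \<subseteq> (\<lambda>p. A *v J \<eta> \<xi> (matrix_inv A *v p)) ` segs_union S"
proof -
  have "segs_union (sheared_pieces \<eta> \<xi> A S) =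
    (*v) A ` segs_union (map_prod (J \<eta> \<xi>) (J \<eta> \<xi>) `
      strip_pieces \<xi> (map_prod ((*v) (matrix_inv A)) ((*v) (matrix_inv A)) ` S))"
    unfolding sheared_pieces_def by (rule segs_union_linear_image[OF matrix_vector_mul_linear])
  also have "\<dots> \<subseteq>
      (*v) A ` J \<eta> \<xi> ` segs_union (map_prod ((*v) (matrix_inv A)) ((*v) (matrix_inv A)) ` S)"
    by (intro image_mono segs_union_J_strip_pieces)
  also have "\<dots> = (\<lambda>p. A *v J \<eta> \<xi> (matrix_inv A *v p)) ` segs_union S"
    by (simp add: segs_union_linear_image[OF matrix_vector_mul_linear] image_image)
  finally show ?thesis .
qed

lemma sheared_pieces_direction_length:
  fixes A :: "real^2^2"
  assumes inv: "invertible A" and v: "v = A *v vector [0, 1]"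
    and "0 < \<xi>" "\<eta> \<noteq> 0" "0 < \<delta>" "\<delta> < pi / 2"
    and flat: "flat_segments 0 K (map_prod ((*v) (matrix_inv A)) ((*v) (matrix_inv A)) ` S)"
    and small: "onorm ((*v) A) * ((1 + K) / (2 * real \<xi>)) \<le> (1 - cos \<delta>) * \<bar>\<eta>\<bar> * norm v"
    and pq: "(p, q) \<in> sheared_pieces \<eta> \<xi> A S"
  shows "(dir_dist (q - p) v < \<delta> \<or> dir_dist (p - q) v < \<delta>) \<and>
    inverse (onorm ((*v) (matrix_inv A))) * \<bar>\<eta>\<bar> < dist p q"
proof -
  let ?S = "map_prod ((*v) (matrix_inv A)) ((*v) (matrix_inv A)) ` S"
  obtain \<alpha> \<beta> where piece: "(\<alpha>, \<beta>) \<in> strip_pieces \<xi> ?S"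
    and pq_eq: "p = A *v J \<eta> \<xi> \<alpha>" "q = A *v J \<eta> \<xi> \<beta>"
    using pq unfolding sheared_pieces_def by auto
  obtain \<sigma> where "\<bar>\<sigma>\<bar> = 1"
    and e: "norm (J \<eta> \<xi> \<beta> - J \<eta> \<xi> \<alpha> - (2 * \<eta> * \<sigma>) *\<^sub>R vector [0, 1]) \<le> (1 + K) / (2 * real \<xi>)"
    using J_strip_piece_displacement[OF piece \<open>0 < \<xi>\<close> flat] by blast
  define \<mu> where "\<mu> = 2 * \<eta> * \<sigma>"
  define e where "e = J \<eta> \<xi> \<beta> - J \<eta> \<xi> \<alpha> - \<mu> *\<^sub>R vector [0, 1]"
  have qp: "q - p = \<mu> *\<^sub>R v + A *v e"
    unfolding pq_eq e_def v by (simp add: algebra_simps)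
  have \<mu>: "\<bar>\<mu>\<bar> = 2 * \<bar>\<eta>\<bar>" "\<mu> \<noteq> 0" unfolding \<mu>_def using \<open>\<bar>\<sigma>\<bar> = 1\<close> \<open>\<eta> \<noteq> 0\<close> by (auto simp: abs_mult)
  have "v \<noteq> 0"
    using matrix_vector_mult_vector_0_1_neq_0[OF inv] v by simp
  have Ae1: "norm (A *v e) \<le> onorm ((*v) A) * norm e"
    by (rule onorm[OF matrix_vector_mul_bounded_linear])
  have Ae2: "onorm ((*v) A) * norm e \<le> onorm ((*v) A) * ((1 + K) / (2 * real \<xi>))"
    using e unfolding e_def \<mu>_def
    by (rule mult_left_mono[OF _ onorm_pos_le[OF matrix_vector_mul_bounded_linear]])
  have Ae3: "norm (A *v e) \<le> (1 - cos \<delta>) * \<bar>\<eta>\<bar> * norm v"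
    by (rule order_trans[OF order_trans[OF Ae1 Ae2] small])
  then have Ae: "norm (A *v e) \<le> (1 - cos \<delta>) / 2 * \<bar>\<mu>\<bar> * norm v"
    unfolding \<mu>(1) by simp
  have "dir_dist (q - p) v < \<delta> \<or> dir_dist (- (q - p)) v < \<delta>"
    unfolding qp using \<open>\<delta> < pi / 2\<close>
    by (intro dir_dist_lt_of_near_line[OF \<open>v \<noteq> 0\<close> \<mu>(2) \<open>0 < \<delta>\<close> _ Ae]) simp
  then have "dir_dist (q - p) v < \<delta> \<or> dir_dist (p - q) v < \<delta>" by simp
  moreover have "inverse (onorm ((*v) (matrix_inv A))) * \<bar>\<eta>\<bar> < dist p q"
  proof -
    have "inverse (onorm ((*v) (matrix_inv A))) \<le> norm v"
      using inverse_onorm_matrix_inv_le[OF inv, of "vector [0, 1]"] v by (simp add: norm_vector_0_1)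
    then have "inverse (onorm ((*v) (matrix_inv A))) * \<bar>\<eta>\<bar> \<le> \<bar>\<eta>\<bar> * norm v"
      by (simp add: mult.commute mult_left_mono)
    also have "\<dots> < (1 - (1 - cos \<delta>) / 2) * \<bar>\<mu>\<bar> * norm v"
      using cos_gt_zero_pi[of \<delta>] \<open>0 < \<delta>\<close> \<open>\<delta> < pi / 2\<close> \<mu>(1) \<open>v \<noteq> 0\<close> \<open>\<eta> \<noteq> 0\<close>
      by (simp add: field_simps)
    also have "\<dots> \<le> norm (\<mu> *\<^sub>R v) - norm (A *v e)" using Ae by (simp add: algebra_simps)
    also have "\<dots> \<le> norm (q - p)" unfolding qp by (rule norm_diff_ineq)
    also have "\<dots> = dist p q" by (metis dist_commute dist_norm)
    finally show ?thesis .
  qed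
  ultimately show ?thesis ..
qed

lemma sheared_pieces_dense:
  fixes A :: "real^2^2"
  assumes inv: "invertible A" and v: "v = A *v vector [0, 1]" and "0 < \<xi>"
    and flat: "flat_segments (2 / real \<xi>) K
      (map_prod ((*v) (matrix_inv A)) ((*v) (matrix_inv A)) ` S)"
    and dense: "eps_dense \<epsilon> (segs_union S) X"
    and small: "onorm ((*v) A) * ((1 + K) / real \<xi>) \<le> \<epsilon>'"
  shows "eps_dense (\<epsilon> + \<epsilon>') (segs_union (sheared_pieces \<eta> \<xi> A S)) (Str X (\<eta> *\<^sub>R v))"
  unfolding eps_dense_def
proof
  let ?B = "(*v) (matrix_inv A)"
  fix y assume "y \<in> Str X (\<eta> *\<^sub>R v)"
  then obtain x \<tau> where x: "x \<in> X" "\<bar>\<tau>\<bar> \<le> 1" "y = x + \<tau> *\<^sub>R (\<eta> *\<^sub>R v)" by (rule Str_memE)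
  obtain g where g: "g \<in> segs_union S" "dist g x < \<epsilon>"
    using dense x(1) unfolding eps_dense_def by blast
  obtain p q where pq: "(p, q) \<in> S" "g \<in> closed_segment p q" using g(1) by (rule segs_unionE)
  have Bg: "?B g \<in> closed_segment (?B p) (?B q)"
    unfolding closed_segment_linear_image[OF matrix_vector_mul_linear] using pq(2) by (rule imageI)
  have BpBq: "(?B p, ?B q) \<in> map_prod ?B ?B ` S" using pq(1) by (rule rev_image_eqI) simp
  obtain Z
    where Z: "Z \<in> segs_union (map_prod (J \<eta> \<xi>) (J \<eta> \<xi>) ` strip_pieces \<xi> (map_prod ?B ?B ` S))"
      "norm (Z - (?B g + (\<tau> * \<eta>) *\<^sub>R vector [0, 1])) \<le> (1 + K) / real \<xi>"
    using J_strip_pieces_dense[OF \<open>0 < \<xi>\<close> flat BpBq Bg x(2)] by blast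
  have "A *v Z \<in> segs_union (sheared_pieces \<eta> \<xi> A S)"
    unfolding sheared_pieces_def segs_union_linear_image[OF matrix_vector_mul_linear]
    using Z(1) by (rule imageI)
  moreover have "dist (A *v Z) y < \<epsilon> + \<epsilon>'"
  proof -
    have "A *v Z - (g + (\<tau> * \<eta>) *\<^sub>R v) = A *v (Z - (?B g + (\<tau> * \<eta>) *\<^sub>R vector [0, 1]))"
      unfolding v by (simp add: matrix_vector_mult_diff_distrib matrix_vector_right_distrib
        matrix_vector_mult_scaleR matrix_vector_mult_inv_right[OF inv])
    then have "norm (A *v Z - (g + (\<tau> * \<eta>) *\<^sub>R v))
        \<le> onorm ((*v) A) * norm (Z - (?B g + (\<tau> * \<eta>) *\<^sub>R vector [0, 1]))"
      using onorm[OF matrix_vector_mul_bounded_linear] by metis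
    also have "\<dots> \<le> onorm ((*v) A) * ((1 + K) / real \<xi>)"
      using Z(2) by (rule mult_left_mono[OF _ onorm_pos_le[OF matrix_vector_mul_bounded_linear]])
    finally have close: "norm (A *v Z - (g + (\<tau> * \<eta>) *\<^sub>R v)) \<le> \<epsilon>'" using small by linarith
    have "A *v Z - y = (A *v Z - (g + (\<tau> * \<eta>) *\<^sub>R v)) + (g - x)"
      unfolding x(3) by (simp add: algebra_simps)
    then have "dist (A *v Z) y \<le> norm (A *v Z - (g + (\<tau> * \<eta>) *\<^sub>R v)) + dist g x"
      by (metis dist_norm norm_triangle_ineq)
    with close g(2) show ?thesis by linarith
  qed
  ultimately show "\<exists>z\<in>segs_union (sheared_pieces \<eta> \<xi> A S). dist z y < \<epsilon> + \<epsilon>'" by blast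
qed

lemma sheared_pieces_properties:
  fixes A :: "real^2^2"
  assumes "det A = 1" and v: "v = A *v vector [0, 1]" and "0 < \<xi>" "\<eta> \<noteq> 0" "0 \<le> l"
    and "0 < \<delta>" "\<delta> \<le> pi / 2" "0 < \<delta>'" "\<delta>' < pi / 2"
    and transversal: "\<forall>(p, q)\<in>S. dir_dist (q - p) v > \<delta> \<and> dir_dist (p - q) v > \<delta> \<and> dist p q > l"
    and dense: "eps_dense \<epsilon> (segs_union S) X"
    and K: "K = onorm ((*v) (matrix_inv A)) / (sin \<delta> * norm v)"
    and wide: "2 / real \<xi> \<le> l * sin \<delta> * norm v"
    and direction_tolerance:
      "onorm ((*v) A) * ((1 + K) / (2 * real \<xi>)) \<le> (1 - cos \<delta>') * \<bar>\<eta>\<bar> * norm v"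
    and density_tolerance: "onorm ((*v) A) * ((1 + K) / real \<xi>) \<le> \<epsilon>'"
  shows "segs_union (sheared_pieces \<eta> \<xi> A S) \<subseteq> (\<lambda>p. A *v J \<eta> \<xi> (matrix_inv A *v p)) ` segs_union S"
    and "eps_dense (\<epsilon> + \<epsilon>') (segs_union (sheared_pieces \<eta> \<xi> A S)) (Str X (\<eta> *\<^sub>R v))"
    and "(p, q) \<in> sheared_pieces \<eta> \<xi> A S \<Longrightarrow> (dir_dist (q - p) v < \<delta>' \<or> dir_dist (p - q) v < \<delta>') \<and>
      inverse (onorm ((*v) (matrix_inv A))) * \<bar>\<eta>\<bar> < dist p q"
proof -
  have inv: "invertible A" using assms(1) by (simp add: invertible_det_nz)
  have flat: "flat_segments (l * sin \<delta> * norm v) K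
    (map_prod ((*v) (matrix_inv A)) ((*v) (matrix_inv A)) ` S)"
    unfolding K using transversal
    by (intro flat_segments_matrix_inv_image[OF assms(1) \<open>0 < \<delta>\<close> \<open>\<delta> \<le> pi / 2\<close> \<open>0 \<le> l\<close> v]) blast
  show "segs_union (sheared_pieces \<eta> \<xi> A S) \<subseteq> (\<lambda>p. A *v J \<eta> \<xi> (matrix_inv A *v p)) ` segs_union S"
    by (rule segs_union_sheared_pieces)
  show "eps_dense (\<epsilon> + \<epsilon>') (segs_union (sheared_pieces \<eta> \<xi> A S)) (Str X (\<eta> *\<^sub>R v))"
    using flat_segments_mono[OF flat wide] dense density_tolerance
    by (rule sheared_pieces_dense[OF inv v \<open>0 < \<xi>\<close>])
  have "0 < 2 / real \<xi>" using \<open>0 < \<xi>\<close> by simp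
  then have "0 \<le> l * sin \<delta> * norm v" using wide by linarith
  note flat0 = flat_segments_mono[OF flat this]
  show "(p, q) \<in> sheared_pieces \<eta> \<xi> A S \<Longrightarrow> (dir_dist (q - p) v < \<delta>' \<or> dir_dist (p - q) v < \<delta>') \<and>
      inverse (onorm ((*v) (matrix_inv A))) * \<bar>\<eta>\<bar> < dist p q"
    by (rule sheared_pieces_direction_length[OF inv v \<open>0 < \<xi>\<close> \<open>\<eta> \<noteq> 0\<close> \<open>0 < \<delta>'\<close> \<open>\<delta>' < pi / 2\<close>
      flat0 direction_tolerance])
qed

theorem mainTheorem12:
  fixes r \<epsilon>' l \<delta> \<delta>' :: real and A :: "real^2^2"
  assumes "r > 0" "\<epsilon>' > 0" "l > 0" "\<delta> > 0" "\<delta>' > 0" "SL2Z A"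
  defines "v \<equiv> A *v vector [0, 1]"
  shows "\<exists>\<xi>0::nat. \<xi>0 \<ge> 1 \<and>
    (\<forall>\<eta> X \<epsilon> S. \<bar>\<eta>\<bar> = r \<and> X \<noteq> {} \<and> \<epsilon> > 0 \<and>
       eps_dense \<epsilon> (segs_union S) X \<and>
       (\<forall>(p,q)\<in>S. dir_dist (q - p) v > \<delta> \<and> dir_dist (p - q) v > \<delta> \<and> dist p q > l) \<longrightarrow>
       (\<forall>\<xi>::nat. \<xi> \<ge> \<xi>0 \<longrightarrow>
          (\<exists>S'. segs_union S' \<subseteq>
                   (\<lambda>p. A *v J \<eta> \<xi> (matrix_inv A *v p)) ` segs_union S \<and>
                 eps_dense (\<epsilon> + \<epsilon>') (segs_union S') (Str X (\<eta> *\<^sub>R v)) \<and>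
                 (\<forall>(p,q)\<in>S'. (dir_dist (q - p) v < \<delta>' \<or> dir_dist (p - q) v < \<delta>') \<and>
                    dist p q > inverse (onorm (\<lambda>x. matrix_inv A *v x)) * \<bar>\<eta>\<bar>))))"
proof -
  have "det A = 1" using \<open>SL2Z A\<close> unfolding SL2Z_def by simp
  have v: "v = A *v vector [0, 1]" unfolding v_def ..
  then have "v \<noteq> 0"
    using matrix_vector_mult_vector_0_1_neq_0 \<open>det A = 1\<close> by (simp add: invertible_det_nz)
  \<comment> \<open>The angle estimates need angles in \<open>(0, \<pi>/2)\<close>; shrinking \<open>\<delta>\<close> and \<open>\<delta>'\<close> weakens the
    hypothesis and strengthens the conclusion.\<close>
  define \<delta>0 where "\<delta>0 = min \<delta> 1"
  define \<delta>1 where "\<delta>1 = min \<delta>' 1"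
  define K where "K = onorm ((*v) (matrix_inv A)) / (sin \<delta>0 * norm v)"
  have \<delta>0: "0 < \<delta>0" "\<delta>0 \<le> pi / 2" "\<delta>0 \<le> \<delta>" and \<delta>1: "0 < \<delta>1" "\<delta>1 < pi / 2" "\<delta>1 \<le> \<delta>'"
    using assms(4,5) pi_gt3 unfolding \<delta>0_def \<delta>1_def by auto
  have "0 < l * sin \<delta>0 * norm v" using assms(3) \<delta>0 \<open>v \<noteq> 0\<close> by (simp add: sin_gt_zero)
  moreover have "0 < (1 - cos \<delta>1) * r * norm v"
    using cos_monotone_0_pi[of 0 \<delta>1] \<delta>1 assms(1) \<open>v \<noteq> 0\<close> by simp
  ultimately have "\<forall>\<^sub>F \<xi> in sequentially. 2 / real \<xi> < l * sin \<delta>0 * norm v \<and>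
      onorm ((*v) A) * (1 + K) / 2 / real \<xi> < (1 - cos \<delta>1) * r * norm v \<and>
      onorm ((*v) A) * (1 + K) / real \<xi> < \<epsilon>'"
    using assms(2) by (intro eventually_conj order_tendstoD(2)[OF lim_const_over_n])
  then obtain N where N: "\<And>\<xi>. N \<le> \<xi> \<Longrightarrow> 2 / real \<xi> < l * sin \<delta>0 * norm v \<and>
      onorm ((*v) A) * (1 + K) / 2 / real \<xi> < (1 - cos \<delta>1) * r * norm v \<and>
      onorm ((*v) A) * (1 + K) / real \<xi> < \<epsilon>'"
    unfolding eventually_sequentially by blast
  show ?thesis
    apply (intro exI[of _ "Suc N"] conjI allI impI)
    subgoal by simp
    subgoal premises H for \<eta> X \<epsilon> S \<xi>
    proof -
      have "\<bar>\<eta>\<bar> = r" "\<eta> \<noteq> 0" "0 < \<xi>" using H assms(1) by auto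
      from N[of \<xi>] H(2) have tolerances: "2 / real \<xi> \<le> l * sin \<delta>0 * norm v"
        "onorm ((*v) A) * ((1 + K) / (2 * real \<xi>)) \<le> (1 - cos \<delta>1) * \<bar>\<eta>\<bar> * norm v"
        "onorm ((*v) A) * ((1 + K) / real \<xi>) \<le> \<epsilon>'"
        unfolding \<open>\<bar>\<eta>\<bar> = r\<close> by simp_all
      have "\<forall>(p, q)\<in>S. dir_dist (q - p) v > \<delta>0 \<and> dir_dist (p - q) v > \<delta>0 \<and> dist p q > l"
        using H(1) \<delta>0(3) by fastforce
      note properties = sheared_pieces_properties[OF \<open>det A = 1\<close> v \<open>0 < \<xi>\<close> \<open>\<eta> \<noteq> 0\<close>
        less_imp_le[OF assms(3)] \<delta>0(1,2) \<delta>1(1,2) this _ K_def tolerances]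
      show ?thesis
        using properties H(1) \<delta>1(3)
        by (intro exI[of _ "sheared_pieces \<eta> \<xi> A S"] conjI ballI) fastforce+
    qed
    done
qed

end
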